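(* Let $G$ be a group and let $X$ be a transitive $G$-space. Let $p\in\beta X$. Then $(\beta G)p=\{qp: q\in\beta G\}$ is a minimal invariant subset of $\beta X$ if and only if, for every $A\in p$, there exists a finite subset $F$ of $G$ such that $G=FA_p$, where $A_p=\{g\in G: A\in gp\}$ and $FA_p=\{fg: f\in F,\ g\in A_p\}$.
   Context: A $G$-space is a set $X$ with an action $G\times X\to X$, $(g,x)\mapsto gx$; it is transitive if for all $x,y\in X$ there is $g\in G$ with $gx=y$. $G$ and $X$ carry the discrete topology, and $\beta G$, $\beta X$ are identified with the sets of all ultrafilters on $G$ and on $X$ (principal ultrafilters identified with points), with the topology whose base consists of the sets $\overline{A}=\{p: A\in p\}$. For $g\in G$ and $p\in\beta X$, $gp=\{gP: P\in p\}$ where $gP=\{gx:x\in P\}$. For $q\in\beta G$ and $p\in\beta X$, $qp$ is the ultrafilter on $X$ given by: $A\in qp$ if and only if $\{g\in G: A\in gp\}\in q$; equivalently, it has as a base the sets $\bigcup_{g\in Q}gP_g$ with $Q\in q$ and $P_g\in p$ for each $g\in Q$ (so $q\mapsto qp$ is the continuous extension of $g\mapsto gp$). A closed subset $S\subseteq\beta X$ is invariant if $gp\in S$ whenever $g\in G$ and $p\in S$; a minimal invariant subset is a nonempty closed invariant subset minimal with respect to inclusion among such sets. *)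

theory Defs
  imports "HOL-Analysis.Abstract_Topology" "HOL-Algebra.Group_Action"
begin

definition ultrafilter_on :: "'a set \<Rightarrow> 'a set set \<Rightarrow> bool" where
  "ultrafilter_on X p \<longleftrightarrow>
     p \<subseteq> Pow X \<and> X \<in> p \<and> {} \<notin> p \<and>
     (\<forall>A\<in>p. \<forall>B\<in>p. A \<inter> B \<in> p) \<and>
     (\<forall>A\<in>p. \<forall>B. A \<subseteq> B \<and> B \<subseteq> X \<longrightarrow> B \<in> p) \<and>
     (\<forall>A. A \<subseteq> X \<longrightarrow> A \<in> p \<or> X - A \<in> p)"

definition ultrafilters :: "'a set \<Rightarrow> 'a set set set" where
  "ultrafilters X = {p. ultrafilter_on X p}"

definition ultra_basic :: "'a set \<Rightarrow> 'a set \<Rightarrow> 'a set set set" where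
  "ultra_basic X A = {p \<in> ultrafilters X. A \<in> p}"

definition stone_cech :: "'a set \<Rightarrow> 'a set set topology" where
  "stone_cech X = topology (arbitrary union_of (\<lambda>U. \<exists>A. A \<subseteq> X \<and> U = ultra_basic X A))"

lemma ultra_basic_Int:
  assumes "A \<subseteq> X" "B \<subseteq> X"
  shows "ultra_basic X A \<inter> ultra_basic X B = ultra_basic X (A \<inter> B)"
proof -
  have "A \<inter> B \<in> p \<longleftrightarrow> A \<in> p \<and> B \<in> p" if p: "ultrafilter_on X p" for p
  proof
    assume AB: "A \<inter> B \<in> p"
    have "\<forall>A\<in>p. \<forall>B. A \<subseteq> B \<and> B \<subseteq> X \<longrightarrow> B \<in> p"
      using p by (simp add: ultrafilter_on_def)
    then show "A \<in> p \<and> B \<in> p"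
      using AB assms by (meson inf_le1 inf_le2)
  next
    assume "A \<in> p \<and> B \<in> p"
    then show "A \<inter> B \<in> p"
      using p by (simp add: ultrafilter_on_def)
  qed
  then show ?thesis
    by (auto simp: ultra_basic_def ultrafilters_def)
qed

lemma openin_stone_cech:
  "openin (stone_cech X) = arbitrary union_of (\<lambda>U. \<exists>A. A \<subseteq> X \<and> U = ultra_basic X A)"
proof -
  have "istopology (arbitrary union_of (\<lambda>U. \<exists>A. A \<subseteq> X \<and> U = ultra_basic X A))"
  proof (rule istopology_base)
    fix S T
    assume "\<exists>A. A \<subseteq> X \<and> S = ultra_basic X A" "\<exists>A. A \<subseteq> X \<and> T = ultra_basic X A"
    then obtain A B where "A \<subseteq> X" "S = ultra_basic X A" "B \<subseteq> X" "T = ultra_basic X B"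
      by blast
    then show "\<exists>A. A \<subseteq> X \<and> S \<inter> T = ultra_basic X A"
      by (intro exI[of _ "A \<inter> B"]) (auto simp: ultra_basic_Int)
  qed
  then show ?thesis
    unfolding stone_cech_def by (rule topology_inverse')
qed

lemma topspace_stone_cech: "topspace (stone_cech X) = ultrafilters X"
proof
  show "topspace (stone_cech X) \<subseteq> ultrafilters X"
    unfolding topspace_def openin_stone_cech
    by (auto simp: union_of_def arbitrary_def ultra_basic_def)
  have "ultra_basic X X = ultrafilters X"
    by (auto simp: ultra_basic_def ultrafilters_def ultrafilter_on_def)
  then have "openin (stone_cech X) (ultrafilters X)"
    unfolding openin_stone_cech
    by (intro union_of_inc) (auto simp: arbitrary_def)
  then show "ultrafilters X \<subseteq> topspace (stone_cech X)"
    by (rule openin_subset)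
qed

definition ultra_act :: "('g \<Rightarrow> 'x \<Rightarrow> 'x) \<Rightarrow> 'g \<Rightarrow> 'x set set \<Rightarrow> 'x set set" where
  "ultra_act \<phi> g p = {\<phi> g ` P | P. P \<in> p}"

definition return_set ::
    "('g, 'm) monoid_scheme \<Rightarrow> ('g \<Rightarrow> 'x \<Rightarrow> 'x) \<Rightarrow> 'x set set \<Rightarrow> 'x set \<Rightarrow> 'g set" where
  "return_set G \<phi> p A = {g \<in> carrier G. A \<in> ultra_act \<phi> g p}"

definition ultra_prod ::
    "('g, 'm) monoid_scheme \<Rightarrow> 'x set \<Rightarrow> ('g \<Rightarrow> 'x \<Rightarrow> 'x) \<Rightarrow> 'g set set \<Rightarrow> 'x set set \<Rightarrow> 'x set set"
  where "ultra_prod G X \<phi> q p = {A. A \<subseteq> X \<and> {g \<in> carrier G. A \<in> ultra_act \<phi> g p} \<in> q}"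

definition closed_invariant ::
    "('g, 'm) monoid_scheme \<Rightarrow> 'x set \<Rightarrow> ('g \<Rightarrow> 'x \<Rightarrow> 'x) \<Rightarrow> 'x set set set \<Rightarrow> bool" where
  "closed_invariant G X \<phi> S \<longleftrightarrow>
     closedin (stone_cech X) S \<and> (\<forall>g\<in>carrier G. \<forall>p\<in>S. ultra_act \<phi> g p \<in> S)"

definition minimal_invariant ::
    "('g, 'm) monoid_scheme \<Rightarrow> 'x set \<Rightarrow> ('g \<Rightarrow> 'x \<Rightarrow> 'x) \<Rightarrow> 'x set set set \<Rightarrow> bool" where
  "minimal_invariant G X \<phi> S \<longleftrightarrow>
     S \<noteq> {} \<and> closed_invariant G X \<phi> S \<and>
     (\<forall>T. T \<noteq> {} \<and> closed_invariant G X \<phi> T \<and> T \<subseteq> S \<longrightarrow> T = S)"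

end

theory Submission
  imports Defs
begin

text \<open>
  The set \<open>(\<beta>G)p\<close> is the closure of the orbit of \<open>p\<close>, so it is minimal if and only if \<open>p\<close> lies
  in the orbit closure of each \<open>qp\<close>, that is, every \<open>A \<in> p\<close> belongs to some translate of each
  \<open>qp\<close>. By compactness of \<open>\<beta>G\<close>, finitely many translates \<open>f A\<^sub>p\<close> cover \<open>G\<close> if and only if every
  \<open>q \<in> \<beta>G\<close> contains one of them. Since \<open>f A\<^sub>p = (f A)\<^sub>p\<close>, and \<open>(f A)\<^sub>p \<in> q\<close> means \<open>f A \<in> qp\<close>,
  the two conditions coincide.
\<close>

no_notation Congruence.eq_closure_of (\<open>closure'_of\<index>\<close>)

section \<open>Ultrafilters\<close>

lemma ultrafilters_iff:
  "p \<in> ultrafilters X \<longleftrightarrow>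
    p \<subseteq> Pow X \<and>
    (\<forall>A\<subseteq>X. \<forall>B\<subseteq>X. A \<inter> B \<in> p \<longleftrightarrow> A \<in> p \<and> B \<in> p) \<and>
    (\<forall>A\<subseteq>X. X - A \<in> p \<longleftrightarrow> A \<notin> p)"
  (is "_ \<longleftrightarrow> ?hom")
proof
  assume "p \<in> ultrafilters X"
  then have p: "p \<subseteq> Pow X" "{} \<notin> p"
    and Int: "\<And>A B. A \<in> p \<Longrightarrow> B \<in> p \<Longrightarrow> A \<inter> B \<in> p"
    and mono: "\<And>A B. A \<in> p \<Longrightarrow> A \<subseteq> B \<Longrightarrow> B \<subseteq> X \<Longrightarrow> B \<in> p"
    and cases: "\<And>A. A \<subseteq> X \<Longrightarrow> A \<in> p \<or> X - A \<in> p"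
    unfolding ultrafilters_def ultrafilter_on_def by blast+
  have "A \<inter> B \<in> p \<longleftrightarrow> A \<in> p \<and> B \<in> p" if "A \<subseteq> X" "B \<subseteq> X" for A B
    using Int mono[of "A \<inter> B"] that by blast
  moreover have "X - A \<in> p \<longleftrightarrow> A \<notin> p" if "A \<subseteq> X" for A
    using Int[of A "X - A"] cases[OF that] p(2) by auto
  ultimately show ?hom
    using p(1) by blast
next
  assume ?hom
  then have p: "p \<subseteq> Pow X"
    and Int: "\<And>A B. A \<subseteq> X \<Longrightarrow> B \<subseteq> X \<Longrightarrow> A \<inter> B \<in> p \<longleftrightarrow> A \<in> p \<and> B \<in> p"
    and Diff: "\<And>A. A \<subseteq> X \<Longrightarrow> X - A \<in> p \<longleftrightarrow> A \<notin> p"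
    by blast+
  have "{} \<notin> p" "X \<in> p"
    using Int[of "{}" X] Diff[of "{}"] by auto
  moreover have "\<forall>A\<in>p. \<forall>B\<in>p. A \<inter> B \<in> p"
    using p Int by blast
  moreover have "\<forall>A\<in>p. \<forall>B. A \<subseteq> B \<and> B \<subseteq> X \<longrightarrow> B \<in> p"
    using Int by (metis Int_absorb2 subset_trans)
  moreover have "\<forall>A. A \<subseteq> X \<longrightarrow> A \<in> p \<or> X - A \<in> p"
    using Diff by blast
  ultimately show "p \<in> ultrafilters X"
    unfolding ultrafilters_def ultrafilter_on_def mem_Collect_eq using p by (intro conjI)
qed

lemma
  assumes "p \<in> ultrafilters X"
  shows ultrafilters_subset: "A \<in> p \<Longrightarrow> A \<subseteq> X"
    and ultrafilters_space_mem: "X \<in> p"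
    and ultrafilters_empty_not_mem: "{} \<notin> p"
  using assms unfolding ultrafilters_def ultrafilter_on_def by blast+

lemma
  assumes "p \<in> ultrafilters X" "A \<subseteq> X"
  shows ultrafilters_Int_iff: "B \<subseteq> X \<Longrightarrow> A \<inter> B \<in> p \<longleftrightarrow> A \<in> p \<and> B \<in> p"
    and ultrafilters_Diff_iff: "X - A \<in> p \<longleftrightarrow> A \<notin> p"
  using assms unfolding ultrafilters_iff by simp_all

lemma ultrafilters_Inter:
  assumes p: "p \<in> ultrafilters X" and "finite F" "F \<subseteq> p"
  shows "X \<inter> \<Inter>F \<in> p"
  using assms(2,3)
proof (induction F)
  case empty
  show ?case using ultrafilters_space_mem[OF p] by simp
next
  case (insert A F)
  then have "A \<inter> (X \<inter> \<Inter>F) \<in> p"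
    using p by (simp add: ultrafilters_Int_iff ultrafilters_subset)
  then show ?case
    by (simp add: Int_left_commute)
qed

lemma ultrafilters_maximal:
  assumes p: "p \<in> ultrafilters X" and q: "q \<in> ultrafilters X" and "p \<subseteq> q"
  shows "p = q"
proof
  show "q \<subseteq> p"
  proof
    fix A assume A: "A \<in> q"
    then have "A \<subseteq> X" using ultrafilters_subset[OF q] by blast
    then show "A \<in> p"
      using A \<open>p \<subseteq> q\<close> ultrafilters_Diff_iff[OF p] ultrafilters_Diff_iff[OF q] by blast
  qed
qed fact

lemma ultrafilters_preimage_hom:
  assumes "q \<in> ultrafilters Y"
    and "\<And>A. A \<subseteq> X \<Longrightarrow> h A \<subseteq> Y"
    and "\<And>A B. A \<subseteq> X \<Longrightarrow> B \<subseteq> X \<Longrightarrow> h (A \<inter> B) = h A \<inter> h B"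
    and "\<And>A. A \<subseteq> X \<Longrightarrow> h (X - A) = Y - h A"
  shows "{A. A \<subseteq> X \<and> h A \<in> q} \<in> ultrafilters X"
  unfolding ultrafilters_iff mem_Collect_eq
proof (intro conjI allI impI)
  fix A B assume "A \<subseteq> X" "B \<subseteq> X"
  then show "A \<inter> B \<subseteq> X \<and> h (A \<inter> B) \<in> q \<longleftrightarrow> (A \<subseteq> X \<and> h A \<in> q) \<and> B \<subseteq> X \<and> h B \<in> q"
    using assms by (simp add: ultrafilters_Int_iff le_infI1)
next
  fix A assume "A \<subseteq> X"
  then show "X - A \<subseteq> X \<and> h (X - A) \<in> q \<longleftrightarrow> \<not> (A \<subseteq> X \<and> h A \<in> q)"
    using assms by (simp add: ultrafilters_Diff_iff)
qed auto

definition has_fip :: "'a set \<Rightarrow> 'a set set \<Rightarrow> bool" where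
  "has_fip X C \<longleftrightarrow> C \<subseteq> Pow X \<and> (\<forall>F. finite F \<and> F \<subseteq> C \<longrightarrow> X \<inter> \<Inter>F \<noteq> {})"

lemma has_fip_Union_chain:
  assumes "\<C> \<noteq> {}" "subset.chain \<A> \<C>" and fip: "\<And>C. C \<in> \<C> \<Longrightarrow> has_fip X C"
  shows "has_fip X (\<Union>\<C>)"
  unfolding has_fip_def
proof (intro conjI allI impI)
  show "\<Union>\<C> \<subseteq> Pow X"
    using fip unfolding has_fip_def by blast
  fix F assume F: "finite F \<and> F \<subseteq> \<Union>\<C>"
  then obtain C where "C \<in> \<C>" "F \<subseteq> C"
    using finite_subset_Union_chain assms(1,2) by metis
  then show "X \<inter> \<Inter>F \<noteq> {}"
    using F fip unfolding has_fip_def by blast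
qed

lemma has_fip_insertI:
  assumes "has_fip X C" "A \<subseteq> X" and A: "\<And>F. finite F \<Longrightarrow> F \<subseteq> C \<Longrightarrow> A \<inter> \<Inter>F \<noteq> {}"
  shows "has_fip X (insert A C)"
  unfolding has_fip_def
proof (intro conjI allI impI)
  show "insert A C \<subseteq> Pow X"
    using assms(1,2) unfolding has_fip_def by blast
  fix F assume "finite F \<and> F \<subseteq> insert A C"
  then have "A \<inter> \<Inter>(F - {A}) \<noteq> {}"
    by (intro A) auto
  then show "X \<inter> \<Inter>F \<noteq> {}"
    using \<open>A \<subseteq> X\<close> by blast
qed

lemma maximal_fip_in_ultrafilters:
  assumes fip: "has_fip X M" and max: "\<And>D. has_fip X D \<Longrightarrow> M \<subseteq> D \<Longrightarrow> D = M"
  shows "M \<in> ultrafilters X"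
proof -
  have M: "X \<inter> \<Inter>F \<noteq> {}" if "finite F" "F \<subseteq> M" for F
    using fip that unfolding has_fip_def by blast
  have mem: "A \<in> M" if "A \<subseteq> X" "\<And>F. finite F \<Longrightarrow> F \<subseteq> M \<Longrightarrow> A \<inter> \<Inter>F \<noteq> {}" for A
    using max[OF has_fip_insertI[OF fip that]] by blast
  have Int: "A \<inter> B \<in> M \<longleftrightarrow> A \<in> M \<and> B \<in> M" if AB: "A \<subseteq> X" "B \<subseteq> X" for A B
  proof
    assume "A \<inter> B \<in> M"
    then have "A \<inter> \<Inter>F \<noteq> {}" "B \<inter> \<Inter>F \<noteq> {}" if "finite F" "F \<subseteq> M" for F
      using M[of "insert (A \<inter> B) F"] that by auto
    then show "A \<in> M \<and> B \<in> M"
      using mem[OF AB(1)] mem[OF AB(2)] by simp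
  next
    assume "A \<in> M \<and> B \<in> M"
    then have "A \<inter> B \<inter> \<Inter>F \<noteq> {}" if "finite F" "F \<subseteq> M" for F
      using M[of "insert A (insert B F)"] that by auto
    then show "A \<inter> B \<in> M"
      by (rule mem[OF le_infI1[OF AB(1)]])
  qed
  have Diff: "X - A \<in> M \<longleftrightarrow> A \<notin> M" if A: "A \<subseteq> X" for A
  proof
    show "A \<notin> M" if "X - A \<in> M"
      using M[of "{A, X - A}"] that by auto
    assume "A \<notin> M"
    then obtain F where F: "finite F" "F \<subseteq> M" "A \<inter> \<Inter>F = {}"
      using mem[OF A] by blast
    have "(X - A) \<inter> \<Inter>F' \<noteq> {}" if "finite F'" "F' \<subseteq> M" for F'
      using M[of "F \<union> F'"] F that by blast
    then show "X - A \<in> M"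
      by (intro mem) auto
  qed
  show ?thesis
    unfolding ultrafilters_iff using fip Int Diff by (simp add: has_fip_def)
qed

lemma has_fip_extend_ultrafilter:
  assumes "has_fip X C"
  obtains q where "q \<in> ultrafilters X" "C \<subseteq> q"
proof -
  let ?\<A> = "{D. has_fip X D \<and> C \<subseteq> D}"
  have "\<exists>M\<in>?\<A>. \<forall>D\<in>?\<A>. M \<subseteq> D \<longrightarrow> D = M"
  proof (rule subset_Zorn_nonempty)
    show "?\<A> \<noteq> {}"
      using assms by blast
    fix \<C> assume "\<C> \<noteq> {}" and chain: "subset.chain ?\<A> \<C>"
    moreover have "\<C> \<subseteq> ?\<A>"
      using chain by (simp add: subset_chain_def)
    ultimately show "\<Union>\<C> \<in> ?\<A>"
      using has_fip_Union_chain[of \<C> ?\<A> X] by blast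
  qed
  then obtain M where M: "has_fip X M" "C \<subseteq> M" and max: "\<forall>D\<in>?\<A>. M \<subseteq> D \<longrightarrow> D = M"
    by blast
  have "D = M" if "has_fip X D" "M \<subseteq> D" for D
    using max M(2) that by simp
  then have "M \<in> ultrafilters X"
    by (rule maximal_fip_in_ultrafilters[OF M(1)])
  then show thesis
    using M(2) by (rule that)
qed

lemma ultrafilters_finite_cover:
  assumes q: "q \<in> ultrafilters X" and "finite F"
    and B: "\<And>i. i \<in> F \<Longrightarrow> B i \<subseteq> X" and cover: "X \<subseteq> (\<Union>i\<in>F. B i)"
  shows "\<exists>i\<in>F. B i \<in> q"
proof (rule ccontr)
  assume "\<not> ?thesis"
  then have "X - B i \<in> q" if "i \<in> F" for i
    using that B ultrafilters_Diff_iff[OF q] by auto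
  then have "X \<inter> (\<Inter>i\<in>F. X - B i) \<in> q"
    using \<open>finite F\<close> by (intro ultrafilters_Inter[OF q]) auto
  moreover have "X \<inter> (\<Inter>i\<in>F. X - B i) = {}"
    using cover by blast
  ultimately show False
    using ultrafilters_empty_not_mem[OF q] by simp
qed

lemma ultrafilter_avoiding_cover:
  assumes B: "\<And>i. i \<in> I \<Longrightarrow> B i \<subseteq> X"
    and no_subcover: "\<And>F. finite F \<Longrightarrow> F \<subseteq> I \<Longrightarrow> X \<noteq> (\<Union>i\<in>F. B i)"
  obtains q where "q \<in> ultrafilters X" "\<And>i. i \<in> I \<Longrightarrow> B i \<notin> q"
proof -
  have "X \<inter> \<Inter>\<F> \<noteq> {}" if \<F>: "finite \<F>" "\<F> \<subseteq> (\<lambda>i. X - B i) ` I" for \<F>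
  proof -
    obtain F where F: "F \<subseteq> I" "finite F" "\<F> = (\<lambda>i. X - B i) ` F"
      using finite_subset_image[OF \<F>] by blast
    have "(\<Union>i\<in>F. B i) \<subseteq> X"
      using B F(1) by blast
    then obtain x where "x \<in> X" "x \<notin> (\<Union>i\<in>F. B i)"
      using no_subcover[OF F(2,1)] by blast
    then show ?thesis
      unfolding F(3) by blast
  qed
  then have "has_fip X ((\<lambda>i. X - B i) ` I)"
    unfolding has_fip_def by blast
  then obtain q where q: "q \<in> ultrafilters X" "(\<lambda>i. X - B i) ` I \<subseteq> q"
    by (rule has_fip_extend_ultrafilter)
  have "B i \<notin> q" if "i \<in> I" for i
  proof -
    have "X - B i \<in> q"
      using q(2) that by blast
    then show ?thesis
      using ultrafilters_Diff_iff[OF q(1) B[OF that]] by simp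
  qed
  then show thesis
    by (rule that[OF q(1)])
qed

text \<open>Compactness of the space of ultrafilters, stated for the sets that index its basic open sets.\<close>

lemma finite_subcover_iff_ultrafilters:
  assumes B: "\<And>i. i \<in> I \<Longrightarrow> B i \<subseteq> X"
  shows "(\<exists>F. finite F \<and> F \<subseteq> I \<and> X = (\<Union>i\<in>F. B i)) \<longleftrightarrow> (\<forall>q\<in>ultrafilters X. \<exists>i\<in>I. B i \<in> q)"
proof (intro iffI ballI)
  fix q assume q: "q \<in> ultrafilters X" and "\<exists>F. finite F \<and> F \<subseteq> I \<and> X = (\<Union>i\<in>F. B i)"
  then obtain F where "finite F" "F \<subseteq> I" "X \<subseteq> (\<Union>i\<in>F. B i)"
    by auto
  then show "\<exists>i\<in>I. B i \<in> q"
    using ultrafilters_finite_cover[OF q, of F B] B by blast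
next
  assume "\<forall>q\<in>ultrafilters X. \<exists>i\<in>I. B i \<in> q"
  then show "\<exists>F. finite F \<and> F \<subseteq> I \<and> X = (\<Union>i\<in>F. B i)"
    using ultrafilter_avoiding_cover[of I B X, OF B] by metis
qed

lemma in_closure_of_stone_cech:
  assumes S: "S \<subseteq> ultrafilters X"
  shows "r \<in> stone_cech X closure_of S \<longleftrightarrow> r \<in> ultrafilters X \<and> (\<forall>A\<in>r. \<exists>s\<in>S. A \<in> s)"
proof (intro iffI conjI ballI)
  assume r: "r \<in> stone_cech X closure_of S"
  then show rX: "r \<in> ultrafilters X"
    by (simp add: in_closure_of topspace_stone_cech)
  fix A assume "A \<in> r"
  then have "r \<in> ultra_basic X A"
    using rX by (simp add: ultra_basic_def)
  moreover have "openin (stone_cech X) (ultra_basic X A)"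
    unfolding openin_stone_cech
    using ultrafilters_subset[OF rX \<open>A \<in> r\<close>] by (intro arbitrary_union_of_inc) blast
  ultimately obtain s where "s \<in> S" "s \<in> ultra_basic X A"
    using r unfolding in_closure_of by blast
  then show "\<exists>s\<in>S. A \<in> s"
    unfolding ultra_basic_def by blast
next
  assume r: "r \<in> ultrafilters X \<and> (\<forall>A\<in>r. \<exists>s\<in>S. A \<in> s)"
  have "\<exists>s. s \<in> S \<and> s \<in> U" if U: "r \<in> U" "openin (stone_cech X) U" for U
  proof -
    obtain A where "r \<in> ultra_basic X A" "ultra_basic X A \<subseteq> U"
      using U unfolding openin_stone_cech arbitrary_union_of_alt by blast
    then show ?thesis
      using r S unfolding ultra_basic_def by blast
  qed
  then show "r \<in> stone_cech X closure_of S"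
    using r by (simp add: in_closure_of topspace_stone_cech)
qed

section \<open>Syndetic sets\<close>

definition (in group) syndetic :: "'a set \<Rightarrow> bool" where
  "syndetic S \<longleftrightarrow> (\<exists>F. finite F \<and> F \<subseteq> carrier G \<and> carrier G = F <#> S)"

lemma (in group) syndetic_iff_ultrafilters:
  assumes "S \<subseteq> carrier G"
  shows "syndetic S \<longleftrightarrow> (\<forall>q\<in>ultrafilters (carrier G). \<exists>f\<in>carrier G. f <# S \<in> q)"
proof -
  have "F <#> S = (\<Union>f\<in>F. f <# S)" for F
    unfolding set_mult_def l_coset_def ..
  then show ?thesis
    unfolding syndetic_def
    using finite_subcover_iff_ultrafilters[of "carrier G" "\<lambda>f. f <# S"] l_coset_subset_G[OF assms]
    by simp
qed

section \<open>The action on ultrafilters\<close>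

lemma ultra_act_eq_image: "ultra_act \<phi> g p = (`) (\<phi> g) ` p"
  unfolding ultra_act_def by blast

sublocale group_action \<subseteq> group G
  using group_hom by (rule group_hom.axioms(1))

context group_action
begin

lemma image_subset_E: "g \<in> carrier G \<Longrightarrow> A \<subseteq> E \<Longrightarrow> \<phi> g ` A \<subseteq> E"
  using surj_prop by blast

lemma image_mult:
  assumes "g \<in> carrier G" "h \<in> carrier G" "A \<subseteq> E"
  shows "\<phi> (g \<otimes> h) ` A = \<phi> g ` \<phi> h ` A"
  unfolding image_image using assms by (intro image_cong composition_rule) auto

lemma image_one:
  assumes "A \<subseteq> E"
  shows "\<phi> \<one> ` A = A"
proof -
  have "\<phi> \<one> ` A = (\<lambda>x. x) ` A"
    using assms by (intro image_cong) (auto simp flip: id_eq_one)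
  then show ?thesis by simp
qed

lemma image_inv_image:
  assumes "g \<in> carrier G" "A \<subseteq> E"
  shows "\<phi> (inv g) ` \<phi> g ` A = A" "\<phi> g ` \<phi> (inv g) ` A = A"
  using assms image_mult[of "inv g" g A] image_mult[of g "inv g" A] image_one by auto

lemma ultra_act_eq_preimage:
  assumes p: "p \<in> ultrafilters E" and g: "g \<in> carrier G"
  shows "ultra_act \<phi> g p = {A. A \<subseteq> E \<and> \<phi> (inv g) ` A \<in> p}"
proof (intro equalityI subsetI)
  fix A assume "A \<in> ultra_act \<phi> g p"
  then obtain P where "P \<in> p" "A = \<phi> g ` P"
    unfolding ultra_act_def by blast
  then show "A \<in> {A. A \<subseteq> E \<and> \<phi> (inv g) ` A \<in> p}"
    using ultrafilters_subset[OF p] image_subset_E[OF g] image_inv_image(1)[OF g] by simp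
next
  fix A assume "A \<in> {A. A \<subseteq> E \<and> \<phi> (inv g) ` A \<in> p}"
  then show "A \<in> ultra_act \<phi> g p"
    using image_inv_image(2)[OF g, of A, symmetric] unfolding ultra_act_def by blast
qed

lemma ultra_act_in_ultrafilters:
  assumes p: "p \<in> ultrafilters E" and g: "g \<in> carrier G"
  shows "ultra_act \<phi> g p \<in> ultrafilters E"
proof -
  have inv_g: "inv g \<in> carrier G"
    using g by simp
  note inj = inj_prop[OF inv_g] and surj = surj_prop[OF inv_g]
  have "\<phi> (inv g) ` (E - A) = E - \<phi> (inv g) ` A" if "A \<subseteq> E" for A
    using inj_on_image_set_diff[OF inj Diff_subset that] surj by simp
  then show ?thesis
    unfolding ultra_act_eq_preimage[OF assms]
    using image_subset_E[OF inv_g] inj_on_image_Int[OF inj]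
    by (intro ultrafilters_preimage_hom[OF p])
qed

lemma ultra_act_mult:
  assumes p: "p \<in> ultrafilters E" and "g \<in> carrier G" "h \<in> carrier G"
  shows "ultra_act \<phi> (g \<otimes> h) p = ultra_act \<phi> g (ultra_act \<phi> h p)"
  unfolding ultra_act_eq_image image_image[of "(`) (\<phi> g)"]
  using assms ultrafilters_subset[OF p] by (intro image_cong image_mult) auto

lemma ultra_act_one:
  assumes p: "p \<in> ultrafilters E"
  shows "ultra_act \<phi> \<one> p = p"
proof -
  have "(`) (\<phi> \<one>) ` p = (\<lambda>P. P) ` p"
    using ultrafilters_subset[OF p] by (intro image_cong image_one) auto
  then show ?thesis
    by (simp add: ultra_act_eq_image)
qed

lemma image_mem_ultra_act_mult:
  assumes "p \<in> ultrafilters E" "g \<in> carrier G" "h \<in> carrier G" "A \<in> ultra_act \<phi> h p"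
  shows "\<phi> g ` A \<in> ultra_act \<phi> (g \<otimes> h) p"
  using assms by (simp add: ultra_act_mult ultra_act_eq_image[of \<phi> g])

lemma return_set_subset: "return_set G \<phi> p A \<subseteq> carrier G"
  unfolding return_set_def by blast

lemma l_coset_return_set:
  assumes p: "p \<in> ultrafilters E" and A: "A \<subseteq> E" and f: "f \<in> carrier G"
  shows "f <# return_set G \<phi> p A = return_set G \<phi> p (\<phi> f ` A)"
proof
  show "f <# return_set G \<phi> p A \<subseteq> return_set G \<phi> p (\<phi> f ` A)"
    using image_mem_ultra_act_mult[OF p f] f unfolding l_coset_def return_set_def by auto
  show "return_set G \<phi> p (\<phi> f ` A) \<subseteq> f <# return_set G \<phi> p A"
  proof
    fix g assume "g \<in> return_set G \<phi> p (\<phi> f ` A)"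
    then have g: "g \<in> carrier G" "\<phi> f ` A \<in> ultra_act \<phi> g p"
      unfolding return_set_def by auto
    then have "A \<in> ultra_act \<phi> (inv f \<otimes> g) p"
      using image_mem_ultra_act_mult[OF p _ g, of "inv f"] f A by (simp add: image_inv_image)
    then have "inv f \<otimes> g \<in> return_set G \<phi> p A"
      using f g(1) by (simp add: return_set_def)
    moreover have "g = f \<otimes> (inv f \<otimes> g)"
      using f g(1) by (simp flip: m_assoc)
    ultimately show "g \<in> f <# return_set G \<phi> p A"
      unfolding l_coset_def by blast
  qed
qed

lemma
  assumes p: "p \<in> ultrafilters E" and A: "A \<subseteq> E"
  shows return_set_Int:
      "B \<subseteq> E \<Longrightarrow> return_set G \<phi> p (A \<inter> B) = return_set G \<phi> p A \<inter> return_set G \<phi> p B"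
    and return_set_Diff: "return_set G \<phi> p (E - A) = carrier G - return_set G \<phi> p A"
  using ultrafilters_Int_iff[OF ultra_act_in_ultrafilters[OF p] A]
    ultrafilters_Diff_iff[OF ultra_act_in_ultrafilters[OF p] A]
  unfolding return_set_def by auto

lemma return_set_mono:
  assumes p: "p \<in> ultrafilters E" and AB: "A \<subseteq> B" "B \<subseteq> E"
  shows "return_set G \<phi> p A \<subseteq> return_set G \<phi> p B"
  using return_set_Int[OF p subset_trans[OF AB] AB(2)] unfolding Int_absorb2[OF AB(1)] by blast

lemma mem_ultra_prod_iff:
  "A \<in> ultra_prod G E \<phi> q p \<longleftrightarrow> A \<subseteq> E \<and> return_set G \<phi> p A \<in> q"
  unfolding ultra_prod_def return_set_def by simp

lemma ultra_prod_in_ultrafilters: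
  assumes p: "p \<in> ultrafilters E" and q: "q \<in> ultrafilters (carrier G)"
  shows "ultra_prod G E \<phi> q p \<in> ultrafilters E"
  unfolding ultra_prod_def return_set_def[symmetric]
  using return_set_subset return_set_Int[OF p] return_set_Diff[OF p]
  by (intro ultrafilters_preimage_hom[OF q])

lemma return_sets_has_fip:
  assumes p: "p \<in> ultrafilters E" and r: "r \<in> ultrafilters E"
    and nonempty: "\<And>A. A \<in> r \<Longrightarrow> return_set G \<phi> p A \<noteq> {}"
  shows "has_fip (carrier G) (return_set G \<phi> p ` r)"
  unfolding has_fip_def
proof (intro conjI allI impI)
  show "return_set G \<phi> p ` r \<subseteq> Pow (carrier G)"
    using return_set_subset by blast
  fix \<F> assume "finite \<F> \<and> \<F> \<subseteq> return_set G \<phi> p ` r"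
  then obtain F where F: "finite F" "F \<subseteq> r" "\<F> = return_set G \<phi> p ` F"
    using finite_subset_image by metis
  let ?B = "E \<inter> \<Inter>F"
  have "return_set G \<phi> p ?B \<subseteq> return_set G \<phi> p A" if "A \<in> F" for A
    using that F(2) ultrafilters_subset[OF r] by (intro return_set_mono[OF p]) auto
  moreover have "return_set G \<phi> p ?B \<noteq> {}"
    using nonempty ultrafilters_Inter[OF r F(1,2)] by blast
  ultimately show "carrier G \<inter> \<Inter>\<F> \<noteq> {}"
    unfolding F(3) using return_set_subset by blast
qed

section \<open>Orbit closures\<close>

definition orbit_closure :: "'c set set \<Rightarrow> 'c set set set" where
  "orbit_closure p = stone_cech E closure_of orbit G (ultra_act \<phi>) p"

lemma orbit_subset_ultrafilters:
  "p \<in> ultrafilters E \<Longrightarrow> orbit G (ultra_act \<phi>) p \<subseteq> ultrafilters E"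
  using ultra_act_in_ultrafilters unfolding orbit_def by blast

lemma mem_orbit_closure_iff:
  assumes "p \<in> ultrafilters E"
  shows "r \<in> orbit_closure p \<longleftrightarrow>
    r \<in> ultrafilters E \<and> (\<forall>A\<in>r. return_set G \<phi> p A \<noteq> {})"
  unfolding orbit_closure_def in_closure_of_stone_cech[OF orbit_subset_ultrafilters[OF assms]]
  by (auto simp: orbit_def return_set_def)

lemma orbit_closure_eq_ultra_prods:
  assumes p: "p \<in> ultrafilters E"
  shows "orbit_closure p = {ultra_prod G E \<phi> q p | q. q \<in> ultrafilters (carrier G)}"
proof (intro equalityI subsetI)
  fix r assume "r \<in> orbit_closure p"
  then have r: "r \<in> ultrafilters E" "\<And>A. A \<in> r \<Longrightarrow> return_set G \<phi> p A \<noteq> {}"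
    unfolding mem_orbit_closure_iff[OF p] by auto
  obtain q where q: "q \<in> ultrafilters (carrier G)" "return_set G \<phi> p ` r \<subseteq> q"
    using has_fip_extend_ultrafilter[OF return_sets_has_fip[OF p r]] by metis
  have "r \<subseteq> ultra_prod G E \<phi> q p"
    using q(2) ultrafilters_subset[OF r(1)] by (auto simp: mem_ultra_prod_iff)
  then have "r = ultra_prod G E \<phi> q p"
    by (rule ultrafilters_maximal[OF r(1) ultra_prod_in_ultrafilters[OF p q(1)]])
  then show "r \<in> {ultra_prod G E \<phi> q p | q. q \<in> ultrafilters (carrier G)}"
    using q(1) by blast
next
  fix r assume "r \<in> {ultra_prod G E \<phi> q p | q. q \<in> ultrafilters (carrier G)}"
  then obtain q where q: "q \<in> ultrafilters (carrier G)" "r = ultra_prod G E \<phi> q p"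
    by blast
  then have "return_set G \<phi> p A \<noteq> {}" if "A \<in> r" for A
    using that ultrafilters_empty_not_mem[OF q(1)] by (auto simp: mem_ultra_prod_iff)
  then show "r \<in> orbit_closure p"
    using q ultra_prod_in_ultrafilters[OF p] by (simp add: mem_orbit_closure_iff[OF p])
qed

lemma self_mem_orbit_closure:
  assumes p: "p \<in> ultrafilters E"
  shows "p \<in> orbit_closure p"
proof -
  have "\<one> \<in> return_set G \<phi> p A" if "A \<in> p" for A
    using that ultra_act_one[OF p] by (simp add: return_set_def)
  then show ?thesis
    unfolding mem_orbit_closure_iff[OF p] using p by blast
qed

lemma closed_invariant_orbit_closure:
  assumes p: "p \<in> ultrafilters E"
  shows "closed_invariant G E \<phi> (orbit_closure p)"
  unfolding closed_invariant_def
proof (intro conjI ballI)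
  show "closedin (stone_cech E) (orbit_closure p)"
    unfolding orbit_closure_def by simp
  fix g r assume g: "g \<in> carrier G" and "r \<in> orbit_closure p"
  then have r: "r \<in> ultrafilters E" "\<And>A. A \<in> r \<Longrightarrow> return_set G \<phi> p A \<noteq> {}"
    by (auto simp: mem_orbit_closure_iff[OF p])
  have "return_set G \<phi> p (\<phi> g ` A) \<noteq> {}" if "A \<in> r" for A
    using r(2)[OF that] l_coset_return_set[OF p ultrafilters_subset[OF r(1) that] g]
    by (auto simp: l_coset_def)
  then show "ultra_act \<phi> g r \<in> orbit_closure p"
    using ultra_act_in_ultrafilters[OF r(1) g]
    by (simp add: mem_orbit_closure_iff[OF p] ultra_act_eq_image)
qed

lemma orbit_closure_subset:
  assumes T: "closed_invariant G E \<phi> T" and "p \<in> T"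
  shows "orbit_closure p \<subseteq> T"
  unfolding orbit_closure_def
  using assms by (intro closure_of_minimal) (auto simp: closed_invariant_def orbit_def)

lemma minimal_invariant_orbit_closure_iff:
  assumes p: "p \<in> ultrafilters E"
  shows "minimal_invariant G E \<phi> (orbit_closure p) \<longleftrightarrow> (\<forall>r\<in>orbit_closure p. p \<in> orbit_closure r)"
proof (intro iffI ballI)
  fix r assume min: "minimal_invariant G E \<phi> (orbit_closure p)" and r: "r \<in> orbit_closure p"
  then have "r \<in> ultrafilters E"
    by (simp add: mem_orbit_closure_iff[OF p])
  then have "orbit_closure r \<noteq> {}" "closed_invariant G E \<phi> (orbit_closure r)"
    using self_mem_orbit_closure closed_invariant_orbit_closure by blast+
  moreover have "orbit_closure r \<subseteq> orbit_closure p"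
    using closed_invariant_orbit_closure[OF p] r by (rule orbit_closure_subset)
  ultimately have "orbit_closure r = orbit_closure p"
    using min unfolding minimal_invariant_def by blast
  then show "p \<in> orbit_closure r"
    using self_mem_orbit_closure[OF p] by simp
next
  assume recurrent: "\<forall>r\<in>orbit_closure p. p \<in> orbit_closure r"
  have "T = orbit_closure p"
    if "T \<noteq> {}" and T: "closed_invariant G E \<phi> T" and "T \<subseteq> orbit_closure p" for T
  proof -
    obtain r where "r \<in> T"
      using \<open>T \<noteq> {}\<close> by blast
    then have "p \<in> T"
      using orbit_closure_subset[OF T] recurrent \<open>T \<subseteq> orbit_closure p\<close> by blast
    then show ?thesis
      using orbit_closure_subset[OF T] \<open>T \<subseteq> orbit_closure p\<close> by blast
  qed
  then show "minimal_invariant G E \<phi> (orbit_closure p)"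
    using self_mem_orbit_closure[OF p] closed_invariant_orbit_closure[OF p]
    unfolding minimal_invariant_def by blast
qed

lemma return_set_nonempty_iff:
  assumes r: "r \<in> ultrafilters E" and A: "A \<subseteq> E"
  shows "return_set G \<phi> r A \<noteq> {} \<longleftrightarrow> (\<exists>f\<in>carrier G. \<phi> f ` A \<in> r)"
proof -
  have "return_set G \<phi> r A = {g \<in> carrier G. \<phi> (inv g) ` A \<in> r}"
    using A unfolding return_set_def by (auto simp: ultra_act_eq_preimage[OF r])
  then have "return_set G \<phi> r A \<noteq> {} \<longleftrightarrow> (\<exists>g\<in>carrier G. \<phi> (inv g) ` A \<in> r)"
    by blast
  also have "\<dots> \<longleftrightarrow> (\<exists>f\<in>carrier G. \<phi> f ` A \<in> r)"
    using inv_closed inv_inv by metis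
  finally show ?thesis .
qed

lemma syndetic_return_set_iff:
  assumes p: "p \<in> ultrafilters E" and A: "A \<subseteq> E"
  shows "syndetic (return_set G \<phi> p A) \<longleftrightarrow> (\<forall>r\<in>orbit_closure p. return_set G \<phi> r A \<noteq> {})"
proof -
  have translate_mem_iff: "f <# return_set G \<phi> p A \<in> q \<longleftrightarrow> \<phi> f ` A \<in> ultra_prod G E \<phi> q p"
    if "f \<in> carrier G" for f q
    using that A by (simp add: l_coset_return_set[OF p] mem_ultra_prod_iff image_subset_E)
  have "syndetic (return_set G \<phi> p A) \<longleftrightarrow>
      (\<forall>q\<in>ultrafilters (carrier G). \<exists>f\<in>carrier G. \<phi> f ` A \<in> ultra_prod G E \<phi> q p)"
    unfolding syndetic_iff_ultrafilters[OF return_set_subset] using translate_mem_iff by simp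
  also have "\<dots> \<longleftrightarrow> (\<forall>r\<in>orbit_closure p. \<exists>f\<in>carrier G. \<phi> f ` A \<in> r)"
    unfolding orbit_closure_eq_ultra_prods[OF p] by blast
  also have "\<dots> \<longleftrightarrow> (\<forall>r\<in>orbit_closure p. return_set G \<phi> r A \<noteq> {})"
    using return_set_nonempty_iff[OF _ A] by (simp add: mem_orbit_closure_iff[OF p])
  finally show ?thesis .
qed

end

theorem theorem2p1:
  fixes G :: "('g, 'm) monoid_scheme"
    and X :: "'x set"
    and \<phi> :: "'g \<Rightarrow> 'x \<Rightarrow> 'x"
    and p :: "'x set set"
  assumes "transitive_action G X \<phi>"
    and "p \<in> ultrafilters X"
  shows "minimal_invariant G X \<phi> {ultra_prod G X \<phi> q p | q. q \<in> ultrafilters (carrier G)} \<longleftrightarrow>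
    (\<forall>A\<in>p. \<exists>F. finite F \<and> F \<subseteq> carrier G \<and> carrier G = F <#>\<^bsub>G\<^esub> return_set G \<phi> p A)"
proof -
  interpret transitive_action G X \<phi> by fact
  note p = assms(2)
  have "minimal_invariant G X \<phi> (orbit_closure p) \<longleftrightarrow>
      (\<forall>r\<in>orbit_closure p. p \<in> orbit_closure r)"
    by (rule minimal_invariant_orbit_closure_iff[OF p])
  also have "\<dots> \<longleftrightarrow> (\<forall>A\<in>p. \<forall>r\<in>orbit_closure p. return_set G \<phi> r A \<noteq> {})"
    using p by (auto simp: mem_orbit_closure_iff)
  also have "\<dots> \<longleftrightarrow> (\<forall>A\<in>p. syndetic (return_set G \<phi> p A))"
    using syndetic_return_set_iff[OF p ultrafilters_subset[OF p]] by simp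
  finally show ?thesis
    unfolding orbit_closure_eq_ultra_prods[OF p] syndetic_def .
qed

end
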